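(* Let $V$ be a finite-dimensional vector space over $\mathbb{R}$ and let $G$ be a subgroup of $GL(V)$ (a locally compact group) such that $\{ g \in G \mid \|g\| < 1 \}$ is a non-empty open subset of $G$. Suppose $\mu$ is an adapted probability measure on $G$ such that $\mu(\{ g\in G \mid \|g\| \leq a \}) = 1$ for some $0<a<1$. Then $\mu$ has Liouville property on $V$ (for the linear action of $G$ on $V$).
   Context: $\|g\|$ denotes the operator norm of a linear transformation $g$ of $V$ (with respect to a fixed norm on $V$). Probability measures on a locally compact group $G$ are regular Borel probability measures. For such a measure $\mu$, $G_\mu$ denotes the closed subgroup of $G$ generated by the support of $\mu$; $\mu$ is called adapted if $G_\mu = G$. A $G$-space $E$ is a locally compact space with a continuous $G$-action. A bounded measurable function $f$ on $E$ is called $\mu$-harmonic if $\int f(gx)\,d\mu(g) = f(x)$ for all $x\in E$. The measure $\mu$ has Liouville property on $E$ if every continuous bounded $\mu$-harmonic function on $E$ is $G_\mu$-invariant, i.e. $f(gx)=f(x)$ for all $g\in G_\mu$, $x \in E$. *)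

theory Defs
  imports "HOL-Analysis.Analysis" "HOL-Probability.Probability_Measure" "HOL-Algebra.Group_Action"
begin

text \<open>Groups are HOL-Algebra groups, and a topology on a group \<open>G\<close> is an abstract topology with
  \<open>topspace T = carrier G\<close>.  Locally compact spaces are taken to be Hausdorff.\<close>

definition locally_compact_group :: "('g, 'm) monoid_scheme \<Rightarrow> 'g topology \<Rightarrow> bool" where
  "locally_compact_group G T \<longleftrightarrow>
     group G \<and> topspace T = carrier G \<and> Hausdorff_space T \<and> locally_compact_space T \<and>
     continuous_map (prod_topology T T) T (\<lambda>(g, h). g \<otimes>\<^bsub>G\<^esub> h) \<and>
     continuous_map T T (\<lambda>g. inv\<^bsub>G\<^esub> g)"

definition G_space ::
  "('g, 'm) monoid_scheme \<Rightarrow> 'g topology \<Rightarrow> 'e topology \<Rightarrow> ('g \<Rightarrow> 'e \<Rightarrow> 'e) \<Rightarrow> bool" where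
  "G_space G T E \<phi> \<longleftrightarrow>
     Hausdorff_space E \<and> locally_compact_space E \<and> group_action G (topspace E) \<phi> \<and>
     continuous_map (prod_topology T E) E (\<lambda>(g, x). \<phi> g x)"

definition borel_of :: "'a topology \<Rightarrow> 'a measure" where
  "borel_of X = sigma (topspace X) {U. openin X U}"

definition regular_borel_prob :: "'a topology \<Rightarrow> 'a measure \<Rightarrow> bool" where
  "regular_borel_prob X \<mu> \<longleftrightarrow>
     prob_space \<mu> \<and> sets \<mu> = sets (borel_of X) \<and>
     (\<forall>A\<in>sets \<mu>. emeasure \<mu> A = (INF U\<in>{U. openin X U \<and> A \<subseteq> U}. emeasure \<mu> U)) \<and>
     (\<forall>U. openin X U \<longrightarrow> emeasure \<mu> U = (SUP K\<in>{K. compactin X K \<and> K \<subseteq> U}. emeasure \<mu> K))"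

definition measure_support :: "'a topology \<Rightarrow> 'a measure \<Rightarrow> 'a set" where
  "measure_support X \<mu> = {x \<in> topspace X. \<forall>U. openin X U \<and> x \<in> U \<longrightarrow> emeasure \<mu> U > 0}"

definition closed_subgroup_generated ::
  "('g, 'm) monoid_scheme \<Rightarrow> 'g topology \<Rightarrow> 'g set \<Rightarrow> 'g set" where
  "closed_subgroup_generated G T S = \<Inter>{H. subgroup H G \<and> closedin T H \<and> S \<subseteq> H}"

text \<open>The subgroup written \<open>G\<^sub>\<mu>\<close> in the literature.\<close>

definition subgroup_of_measure ::
  "('g, 'm) monoid_scheme \<Rightarrow> 'g topology \<Rightarrow> 'g measure \<Rightarrow> 'g set" where
  "subgroup_of_measure G T \<mu> = closed_subgroup_generated G T (measure_support T \<mu>)"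

definition adapted :: "('g, 'm) monoid_scheme \<Rightarrow> 'g topology \<Rightarrow> 'g measure \<Rightarrow> bool" where
  "adapted G T \<mu> \<longleftrightarrow> subgroup_of_measure G T \<mu> = carrier G"

text \<open>On a \<open>G\<close>-space, \<open>g \<mapsto> f (\<phi> g x)\<close> is bounded and Borel for bounded Borel \<open>f\<close>, so the integral
  below is never the default value of a non-integrable function.\<close>

definition harmonic ::
  "'g measure \<Rightarrow> 'e topology \<Rightarrow> ('g \<Rightarrow> 'e \<Rightarrow> 'e) \<Rightarrow> ('e \<Rightarrow> real) \<Rightarrow> bool" where
  "harmonic \<mu> E \<phi> f \<longleftrightarrow>
     f \<in> borel_measurable (borel_of E) \<and> bounded (f ` topspace E) \<and>
     (\<forall>x\<in>topspace E. (\<integral>g. f (\<phi> g x) \<partial>\<mu>) = f x)"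

definition liouville_property ::
  "('g, 'm) monoid_scheme \<Rightarrow> 'g topology \<Rightarrow> 'g measure \<Rightarrow> 'e topology \<Rightarrow> ('g \<Rightarrow> 'e \<Rightarrow> 'e) \<Rightarrow> bool"
  where
  "liouville_property G T \<mu> E \<phi> \<longleftrightarrow>
     (\<forall>f. continuous_map E euclideanreal f \<and> harmonic \<mu> E \<phi> f \<longrightarrow>
        (\<forall>g\<in>subgroup_of_measure G T \<mu>. \<forall>x\<in>topspace E. f (\<phi> g x) = f x))"

text \<open>For a finite-dimensional space every linear endomorphism is bounded, so the units of the
  monoid of bounded endomorphisms form the full general linear group, and the norm of the type of
  bounded linear maps is the operator norm for the norm of \<open>'v\<close>.\<close>

definition GL :: "('v::real_normed_vector \<Rightarrow>\<^sub>L 'v) monoid" where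
  "GL = units_of \<lparr>carrier = UNIV, mult = (o\<^sub>L), one = id_blinfun\<rparr>"

end

theory Submission imports Defs
begin

text \<open>Why the statement holds: \<open>\<mu>\<close>-almost every \<open>g\<close> shrinks every vector by the factor \<open>a < 1\<close>, so
  the random walk \<open>g\<^sub>n \<cdots> g\<^sub>1 x\<close> with independent \<open>\<mu>\<close>-distributed steps converges to \<open>0\<close>
  uniformly at the rate \<open>a ^ n\<close>.  A harmonic \<open>f\<close> is constant in mean along the walk, hence
  \<open>f x\<close> is the limit of the mean of \<open>f (g\<^sub>n \<cdots> g\<^sub>1 x)\<close>, which is \<open>f 0\<close> by continuity at \<open>0\<close>.
  Thus every continuous bounded harmonic function is constant, and in particular invariant.

  The product measures on \<open>n\<close> steps can be avoided.  If \<open>\<bar>f - f 0\<bar> \<le> e\<close> on the ball of radius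
  \<open>r\<close>, then averaging once gives the same bound on the ball of radius \<open>r / a\<close>; repeating this
  carries the bound from a small ball, where it is continuity, to the whole space.  This is
  \<open>harmonic_for_contractions_constant\<close>.  The remaining lemmas supply the integrability that the
  averaging step uses.\<close>

text \<open>The averaging step: \<open>f x - c\<close> is the mean of \<open>f (\<phi> g x) - c\<close>, and almost every \<open>\<phi> g x\<close> lies
  in the ball on which the bound is already known.\<close>

lemma harmonic_bound_extends_to_larger_ball:
  fixes f :: "'v::real_normed_vector \<Rightarrow> real"
  assumes "prob_space M"
    and integrable: "integrable M (\<lambda>g. f (\<phi> g x))"
    and mean: "(\<integral>g. f (\<phi> g x) \<partial>M) = f x"
    and contraction: "AE g in M. norm (\<phi> g x) \<le> a * norm x"
    and bound: "\<And>y. norm y \<le> r \<Longrightarrow> \<bar>f y - c\<bar> \<le> e"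
    and "a * norm x \<le> r"
  shows "\<bar>f x - c\<bar> \<le> e"
proof -
  interpret prob_space M by fact
  have "f x - c = (\<integral>g. f (\<phi> g x) - c \<partial>M)"
    using integrable mean by (simp add: prob_space)
  also have "\<bar>\<dots>\<bar> \<le> (\<integral>g. \<bar>f (\<phi> g x) - c\<bar> \<partial>M)"
    by (rule integral_abs_bound)
  also have "\<dots> \<le> e"
  proof (rule integral_le_const)
    show "integrable M (\<lambda>g. \<bar>f (\<phi> g x) - c\<bar>)"
      using integrable by simp
    show "AE g in M. \<bar>f (\<phi> g x) - c\<bar> \<le> e"
      using contraction by eventually_elim (use bound \<open>a * norm x \<le> r\<close> in auto)
  qed
  finally show ?thesis .
qed

lemma harmonic_for_contractions_constant:
  fixes f :: "'v::real_normed_vector \<Rightarrow> real"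
  assumes "prob_space M"
    and integrable: "\<And>x. integrable M (\<lambda>g. f (\<phi> g x))"
    and mean: "\<And>x. (\<integral>g. f (\<phi> g x) \<partial>M) = f x"
    and contraction: "\<And>x. AE g in M. norm (\<phi> g x) \<le> a * norm x"
    and a: "0 < a" "a < 1"
    and "isCont f 0"
  shows "f x = f 0"
proof -
  have "\<bar>f x - f 0\<bar> \<le> e" if "e > 0" for e
  proof -
    obtain d where "d > 0" and d: "\<And>y. norm y < d \<Longrightarrow> \<bar>f y - f 0\<bar> < e"
      using \<open>isCont f 0\<close> \<open>e > 0\<close> unfolding continuous_at_eps_delta
      by (auto simp: dist_norm)
    \<comment> \<open>Half of \<open>d\<close>, because the bound is wanted on closed balls.\<close>
    have ball: "\<bar>f y - f 0\<bar> \<le> e" if "norm y \<le> (d / 2) / a ^ n" for n y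
      using that
    proof (induction n arbitrary: y)
      case 0
      then show ?case using d[of y] \<open>d > 0\<close> by simp
    next
      case (Suc n)
      have "a * norm y \<le> (d / 2) / a ^ n"
        using Suc.prems a by (simp add: field_simps)
      with Suc.IH show ?case
        by (rule harmonic_bound_extends_to_larger_ball[OF assms(1) integrable mean contraction])
    qed
    have "(\<lambda>n. norm x * a ^ n) \<longlonglongrightarrow> norm x * 0"
      using a by (intro tendsto_intros LIMSEQ_power_zero) auto
    then have "\<forall>\<^sub>F n in sequentially. norm x * a ^ n < d / 2"
      using \<open>d > 0\<close> by (intro order_tendstoD(2)[where y = "norm x * 0"]) auto
    then obtain n where "norm x * a ^ n < d / 2"
      by (auto simp: eventually_sequentially)
    then have "norm x \<le> (d / 2) / a ^ n"
      using a by (simp add: field_simps)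
    then show ?thesis by (rule ball)
  qed
  then show ?thesis
    using field_le_epsilon[of "\<bar>f x - f 0\<bar>" 0] by auto
qed

lemma space_borel_of [simp]: "space (borel_of X) = topspace X"
  unfolding borel_of_def by (rule space_measure_of) (auto dest: openin_subset)

lemma sets_borel_of_openin: "openin X U \<Longrightarrow> U \<in> sets (borel_of X)"
  unfolding borel_of_def by (subst sets_measure_of) (auto dest: openin_subset)

lemma continuous_map_borel_measurable:
  fixes h :: "'a \<Rightarrow> 'b::topological_space"
  assumes "continuous_map X euclidean h"
  shows "h \<in> borel_measurable (borel_of X)"
proof (rule borel_measurableI)
  fix S :: "'b set" assume "open S"
  then have "openin X {x \<in> topspace X. h x \<in> S}"
    using assms by (auto intro: openin_continuous_map_preimage)
  moreover have "h -` S \<inter> space (borel_of X) = {x \<in> topspace X. h x \<in> S}"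
    by auto
  ultimately show "h -` S \<inter> space (borel_of X) \<in> sets (borel_of X)"
    by (simp add: sets_borel_of_openin)
qed

text \<open>The Bochner integral of a non-integrable function is \<open>0\<close>, so harmonicity in the sense of an
  integral equation yields the mean value property of \<open>f - f 0\<close> only together with
  integrability along orbits.\<close>

lemma G_space_orbit_integrable:
  fixes f :: "'e \<Rightarrow> real"
  assumes "G_space G T E \<phi>" and "prob_space \<mu>" and sets: "sets \<mu> = sets (borel_of T)"
    and f: "continuous_map E euclideanreal f" and bounded: "bounded (f ` topspace E)"
    and x: "x \<in> topspace E"
  shows "integrable \<mu> (\<lambda>g. f (\<phi> g x))"
proof -
  interpret prob_space \<mu> by fact
  have action: "continuous_map (prod_topology T E) E (\<lambda>(g, x). \<phi> g x)"
    using \<open>G_space G T E \<phi>\<close> by (simp add: G_space_def)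
  have "continuous_map T (prod_topology T E) (\<lambda>g. (g, x))"
    using x by (simp add: continuous_map_pairwise o_def)
  from continuous_map_compose[OF this action]
  have orbit: "continuous_map T E (\<lambda>g. \<phi> g x)"
    by (simp add: o_def)
  have "continuous_map T euclideanreal (\<lambda>g. f (\<phi> g x))"
    using continuous_map_compose[OF orbit f] by (simp add: o_def)
  then have "(\<lambda>g. f (\<phi> g x)) \<in> borel_measurable \<mu>"
    using continuous_map_borel_measurable measurable_cong_sets[OF sets refl] by blast
  moreover obtain B where B: "\<And>y. y \<in> topspace E \<Longrightarrow> norm (f y) \<le> B"
    using bounded unfolding bounded_iff by auto
  have "space \<mu> = topspace T"
    using sets_eq_imp_space_eq[OF sets] by simp
  then have "AE g in \<mu>. norm (f (\<phi> g x)) \<le> B"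
    using continuous_map_funspace[OF orbit] by (intro AE_I2 B) auto
  ultimately show ?thesis
    by (intro integrable_const_bound)
qed

theorem theorem1p1:
  fixes G :: "('v::real_normed_vector \<Rightarrow>\<^sub>L 'v) set"
    and T :: "('v \<Rightarrow>\<^sub>L 'v) topology"
    and \<mu> :: "('v \<Rightarrow>\<^sub>L 'v) measure"
    and a :: real
  assumes "\<exists>B :: 'v set. finite B \<and> span B = UNIV"
    and "subgroup G GL"
    and "locally_compact_group (GL\<lparr>carrier := G\<rparr>) T"
    and "G_space (GL\<lparr>carrier := G\<rparr>) T (euclidean :: 'v topology) blinfun_apply"
    and "{g \<in> G. norm g < 1} \<noteq> {}"
    and "openin T {g \<in> G. norm g < 1}"
    and "regular_borel_prob T \<mu>"
    and "adapted (GL\<lparr>carrier := G\<rparr>) T \<mu>"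
    and "0 < a" and "a < 1"
    and "measure \<mu> {g \<in> G. norm g \<le> a} = 1"
  shows "liouville_property (GL\<lparr>carrier := G\<rparr>) T \<mu> (euclidean :: 'v topology) blinfun_apply"
  unfolding liouville_property_def
proof (intro allI impI ballI)
  fix f :: "'v \<Rightarrow> real" and g and x :: 'v
  assume "continuous_map euclidean euclideanreal f \<and> harmonic \<mu> euclidean blinfun_apply f"
  then have continuous: "continuous_map euclidean euclideanreal f"
    and bounded: "bounded (f ` topspace (euclidean :: 'v topology))"
    and mean: "\<And>y. (\<integral>g. f (blinfun_apply g y) \<partial>\<mu>) = f y"
    by (auto simp: harmonic_def)
  have prob: "prob_space \<mu>" and sets: "sets \<mu> = sets (borel_of T)"
    using assms(7) by (auto simp: regular_borel_prob_def)
  have integrable: "integrable \<mu> (\<lambda>g. f (blinfun_apply g y))" for y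
    by (rule G_space_orbit_integrable[OF assms(4) prob sets continuous bounded]) simp
  have "AE g in \<mu>. g \<in> {g \<in> G. norm g \<le> a}"
    by (rule prob_space.AE_prob_1[OF prob assms(11)])
  then have contraction: "AE g in \<mu>. norm (blinfun_apply g y) \<le> a * norm y" for y
  proof eventually_elim
    case (elim g)
    have "norm (blinfun_apply g y) \<le> norm g * norm y"
      by (rule norm_blinfun)
    also have "\<dots> \<le> a * norm y"
      using elim by (simp add: mult_right_mono)
    finally show ?case .
  qed
  have "isCont f 0"
    using continuous by (simp add: continuous_on_eq_continuous_at)
  then have "f y = f 0" for y
    by (rule harmonic_for_contractions_constant
        [OF prob integrable mean contraction \<open>0 < a\<close> \<open>a < 1\<close>])
  then show "f (blinfun_apply g x) = f x"
    by metis
qed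

end
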